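(* Let $(A,B,p,r,c)$ be an LPP situation with producer set $N$, let $(N,\mathcal{P}(N),\{V(\bullet|P)\}_{P\in\mathcal{P}(N)})$ be the corresponding partition function form game, and let $(N,v^+)$, $(N,v^-)$ be the related games in characteristic function form. If $d_N\le r$, then: 1. $C(v^+)\neq\varnothing$ and $\overline{C}(V)\neq\varnothing$; 2. $C(v^-)\neq\varnothing$ and $C(V)\neq\varnothing$.
   Context: LPP situation (linear production situation with a common-pool resource). $N=\{1,\dots,n\}$ is a set of producers, $G=\{1,\dots,g\}$ a set of goods, $Q=\{1,\dots,q\}$ a set of resources; in addition there is one external common-pool resource, of which a total amount $r\ge 0$ is available at unit cost $c\ge 0$. Producer $i$ owns $b^i\in\mathbb{R}_+^q$; $b^S=\sum_{i\in S}b^i$; $B$ is the $q\times n$ matrix with columns $b^i$, and for every $t\in Q$ there is a producer $i$ with $b^i_t>0$. $A$ is a nonnegative $(q+1)\times g$ matrix ($a_{tj}$ is the amount of resource $t$ needed per unit of good $j$; row $q+1$ refers to the common-pool resource), with $a_{(q+1)j}>0$ for all $j\in G$ and, for every $j\in G$, some $t\in Q$ with $a_{tj}>0$. $p\in\mathbb{R}_{++}^g$ is the price vector and $p_j>a_{(q+1)j}c$ for all $j\in G$. For a coalition $S\subseteq N$ and $z\ge 0$, $$\mathrm{value}(S;z)=\max\Big\{\sum_{j=1}^g p_jx_j-cz \;:\; Ax\le \begin{pmatrix} b^S\\ z\end{pmatrix},\ x\in\mathbb{R}^g_+\Big\}.$$ The optimal demand of $S$ is $d_S=\min\{z\ge 0:\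 \mathrm{value}(S;z)=\max_{z'\ge 0}\mathrm{value}(S;z')\}$. It is assumed that for every nonempty $S$ there is $z$ with $\mathrm{value}(S;z)>0$ (so $d_S>0$). Partition function form game. $\mathcal{P}(N)$ is the set of partitions of $N$ into nonempty coalitions. When partition $P$ forms, the manager of the common-pool resource allocates (by some fixed, otherwise unspecified procedure) an amount $z_S(P)\ge 0$ to each $S\in P$, with $z_S(P)\le d_S$, $\sum_{S\in P}z_S(P)\le r$, and $z_N(\{N\})=\min\{d_N,r\}$. Then $V(S|P)=\mathrm{value}(S;z_S(P))$ for $S\in P$. Define $v^-(S)=\min\{V(S|P): P\in\mathcal{P}(N), S\in P\}$ and $v^+(S)=\max\{V(S|P): P\in\mathcal{P}(N), S\in P\}$ for nonempty $S$, and $v^\pm(\varnothing)=0$. Cores. The core of a characteristic function form game $(N,v)$ is $C(v)=\{x\in\mathbb{R}^N: \sum_{i\in N}x_i=v(N),\ \sum_{i\in S}x_i\ge v(S)\ \forall S\subseteq N\}$. For $V$: $x\in\mathbb{R}^N$ is feasible under $P$ if $\sum_{i\in S}x_i\le V(S|P)$ for all $S\in P$; $\mathcal{F}$ is the set of vectors feasible under some $P\in\mathcal{P}(N)$. $x$ $dom$ $x'$ if there is a nonempty $S\subseteq N$ with $x_i>x'_i$ for all $i\in S$ and $\sum_{i\in S}x_i\le V(S|P)$ for all $P\ni S$; $x$ $\overline{dom}$ $x'$ if there is a nonempty $S\subseteq N$ with $x_i>x'_i$ for all $i\in S$ and $\sum_{i\in S}x_i\le V(S|P)$ for some $P\ni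 S$. $C(V)=\{x\in\mathcal{F}: \nexists x'\in\mathcal{F},\ x'\,dom\,x\}$ and $\overline{C}(V)=\{x\in\mathcal{F}: \nexists x'\in\mathcal{F},\ x'\,\overline{dom}\,x\}$. *)

theory Defs
  imports "HOL-Analysis.Analysis" "HOL-Library.Disjoint_Sets"
begin

text \<open>
  Producers, goods and owned resources are indexed by finite types 'n, 'g and 'q, so that
  N is UNIV. The q + 1 rows of the technology matrix are indexed by 'q option: row Some t
  belongs to the owned resource t, row None to the common-pool resource.
\<close>

definition coalition_resources :: "real ^ 'n ^ 'q \<Rightarrow> 'n set \<Rightarrow> real ^ 'q" where
  "coalition_resources B S = (\<Sum>i\<in>S. column i B)"

definition available :: "real ^ 'n ^ 'q \<Rightarrow> 'n set \<Rightarrow> real \<Rightarrow> real ^ ('q option)" where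
  "available B S z = (\<chi> t. case t of None \<Rightarrow> z | Some t' \<Rightarrow> coalition_resources B S $ t')"

definition production_plans ::
  "real ^ 'g ^ ('q option) \<Rightarrow> real ^ 'n ^ 'q \<Rightarrow> 'n set \<Rightarrow> real \<Rightarrow> (real ^ 'g) set" where
  "production_plans A B S z = {x. A *v x \<le> available B S z \<and> 0 \<le> x}"

definition lp_value ::
  "real ^ 'g ^ ('q option) \<Rightarrow> real ^ 'n ^ 'q \<Rightarrow> real ^ 'g \<Rightarrow> real \<Rightarrow> 'n set \<Rightarrow> real \<Rightarrow> real" where
  "lp_value A B p c S z = (GREATEST v. \<exists>x\<in>production_plans A B S z. v = p \<bullet> x - c * z)"

definition optimal_demand ::
  "real ^ 'g ^ ('q option) \<Rightarrow> real ^ 'n ^ 'q \<Rightarrow> real ^ 'g \<Rightarrow> real \<Rightarrow> 'n set \<Rightarrow> real" where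
  "optimal_demand A B p c S =
     (LEAST z. 0 \<le> z \<and> lp_value A B p c S z = (GREATEST v. \<exists>z'\<ge>0. v = lp_value A B p c S z'))"

definition lpp_situation ::
  "real ^ 'g ^ ('q option) \<Rightarrow> real ^ 'n ^ 'q \<Rightarrow> real ^ 'g \<Rightarrow> real \<Rightarrow> real \<Rightarrow> bool" where
  "lpp_situation A B p r c \<longleftrightarrow>
     0 \<le> r \<and> 0 \<le> c \<and>
     (\<forall>t i. 0 \<le> B $ t $ i) \<and>
     (\<forall>t. \<exists>i. 0 < B $ t $ i) \<and>
     (\<forall>t j. 0 \<le> A $ t $ j) \<and>
     (\<forall>j. 0 < A $ None $ j) \<and>
     (\<forall>j. \<exists>t. 0 < A $ Some t $ j) \<and>
     (\<forall>j. 0 < p $ j) \<and>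
     (\<forall>j. A $ None $ j * c < p $ j) \<and>
     (\<forall>S. S \<noteq> {} \<longrightarrow> (\<exists>z\<ge>0. 0 < lp_value A B p c S z))"

text \<open>
  In the following, z S P is the amount of the common-pool resource that the manager assigns
  to coalition S when partition P forms; it is constrained only where P is a partition of N
  and S belongs to P.
\<close>

definition manager_allocation ::
  "real ^ 'g ^ ('q option) \<Rightarrow> real ^ 'n ^ 'q \<Rightarrow> real ^ 'g \<Rightarrow> real \<Rightarrow> real
     \<Rightarrow> ('n set \<Rightarrow> 'n set set \<Rightarrow> real) \<Rightarrow> bool" where
  "manager_allocation A B p r c z \<longleftrightarrow>
     (\<forall>P. partition_on UNIV P \<longrightarrow>
        (\<forall>S\<in>P. 0 \<le> z S P \<and> z S P \<le> optimal_demand A B p c S) \<and>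
        (\<Sum>S\<in>P. z S P) \<le> r) \<and>
     z UNIV {UNIV} = min (optimal_demand A B p c UNIV) r"

definition lpp_game ::
  "real ^ 'g ^ ('q option) \<Rightarrow> real ^ 'n ^ 'q \<Rightarrow> real ^ 'g \<Rightarrow> real
     \<Rightarrow> ('n set \<Rightarrow> 'n set set \<Rightarrow> real) \<Rightarrow> 'n set \<Rightarrow> 'n set set \<Rightarrow> real" where
  "lpp_game A B p c z S P = lp_value A B p c S (z S P)"

text \<open>
  A partition function form game is a function V where V S P stands for V(S|P); only its
  values at partitions P of N and members S of P are ever used.
\<close>

definition v_minus :: "('n::finite set \<Rightarrow> 'n set set \<Rightarrow> real) \<Rightarrow> 'n set \<Rightarrow> real" where
  "v_minus V S = (if S = {} then 0 else Min {V S P |P. partition_on UNIV P \<and> S \<in> P})"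

definition v_plus :: "('n::finite set \<Rightarrow> 'n set set \<Rightarrow> real) \<Rightarrow> 'n set \<Rightarrow> real" where
  "v_plus V S = (if S = {} then 0 else Max {V S P |P. partition_on UNIV P \<and> S \<in> P})"

definition core :: "('n set \<Rightarrow> real) \<Rightarrow> (real ^ 'n) set" where
  "core v = {x. (\<Sum>i\<in>UNIV. x $ i) = v UNIV \<and> (\<forall>S. v S \<le> (\<Sum>i\<in>S. x $ i))}"

definition feasible_under ::
  "('n set \<Rightarrow> 'n set set \<Rightarrow> real) \<Rightarrow> 'n set set \<Rightarrow> real ^ 'n \<Rightarrow> bool" where
  "feasible_under V P x \<longleftrightarrow> (\<forall>S\<in>P. (\<Sum>i\<in>S. x $ i) \<le> V S P)"

definition feasible_set :: "('n set \<Rightarrow> 'n set set \<Rightarrow> real) \<Rightarrow> (real ^ 'n) set" where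
  "feasible_set V = {x. \<exists>P. partition_on UNIV P \<and> feasible_under V P x}"

definition dom_all ::
  "('n set \<Rightarrow> 'n set set \<Rightarrow> real) \<Rightarrow> real ^ 'n \<Rightarrow> real ^ 'n \<Rightarrow> bool" where
  "dom_all V x x' \<longleftrightarrow>
     (\<exists>S. S \<noteq> {} \<and> (\<forall>i\<in>S. x' $ i < x $ i) \<and>
        (\<forall>P. partition_on UNIV P \<and> S \<in> P \<longrightarrow> (\<Sum>i\<in>S. x $ i) \<le> V S P))"

definition dom_some ::
  "('n set \<Rightarrow> 'n set set \<Rightarrow> real) \<Rightarrow> real ^ 'n \<Rightarrow> real ^ 'n \<Rightarrow> bool" where
  "dom_some V x x' \<longleftrightarrow>
     (\<exists>S. S \<noteq> {} \<and> (\<forall>i\<in>S. x' $ i < x $ i) \<and>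
        (\<exists>P. partition_on UNIV P \<and> S \<in> P \<and> (\<Sum>i\<in>S. x $ i) \<le> V S P))"

text \<open>
  The core C(V) is defined by dom_all, and the core written with an overline by dom_some.
\<close>

definition pff_core :: "('n set \<Rightarrow> 'n set set \<Rightarrow> real) \<Rightarrow> (real ^ 'n) set" where
  "pff_core V = {x \<in> feasible_set V. \<not> (\<exists>x'\<in>feasible_set V. dom_all V x' x)}"

definition pff_core_bar :: "('n set \<Rightarrow> 'n set set \<Rightarrow> real) \<Rightarrow> (real ^ 'n) set" where
  "pff_core_bar V = {x \<in> feasible_set V. \<not> (\<exists>x'\<in>feasible_set V. dom_some V x' x)}"

end

theory Submission
  imports Defs
begin

text \<open>
  Since the common-pool resource costs c per unit, a coalition with an unrestricted supply of it
  solves the linear program with unit profits p - c * A $ None and the owned resources as only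
  constraints; the optimum of this program bounds V(S|P) for every P. As d_N \<le> r, the grand
  coalition attains its own optimum, so pricing the owned resources by an optimal dual solution
  for N yields a core element of v_plus (Owen's argument). That element also lies in the other
  three cores, by comparing the blocking conditions.
\<close>

section \<open>Linear programming\<close>

text \<open>
  Every resource is available in a positive amount, so Slater's condition holds at x = 0 and
  the hyperplane separating the attainable pairs (resources, profit) from the unattainable
  profits at b is not vertical. No closedness of the attainable set is needed.
\<close>

lemma strong_duality_slater:
  fixes M :: "real ^ 'g::finite ^ 'q::finite" and b :: "real ^ 'q" and w :: "real ^ 'g"
  assumes b: "\<And>t. 0 < b $ t"
    and bound: "\<And>x. 0 \<le> x \<Longrightarrow> M *v x \<le> b \<Longrightarrow> w \<bullet> x \<le> m"
  obtains y where "0 \<le> y" and "\<And>x. 0 \<le> x \<Longrightarrow> w \<bullet> x \<le> y \<bullet> (M *v x)" and "y \<bullet> b \<le> m"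
proof -
  \<comment> \<open>\<open>C\<close> allows waste: \<open>u\<close> only bounds the resource use
    from above and \<open>s\<close> may fall short of the profit. Upward closure in \<open>u\<close>
    makes the resource part \<open>a1\<close> of the normal nonpositive.\<close>
  define C where "C = {(u, s). \<exists>x. 0 \<le> x \<and> M *v x \<le> u \<and> s \<le> w \<bullet> x}"
  define D where "D = {b} \<times> {m<..}"
  have CI: "(u, s) \<in> C" if "0 \<le> x" "M *v x \<le> u" "s \<le> w \<bullet> x" for u s x
    using that unfolding C_def by blast
  have "convex C"
  proof (rule convexI)
    fix v1 v2 and k l :: real
    assume v: "v1 \<in> C" "v2 \<in> C" and kl: "0 \<le> k" "0 \<le> l" "k + l = 1"
    obtain u1 s1 x1 where 1: "v1 = (u1, s1)" "0 \<le> x1" "M *v x1 \<le> u1" "s1 \<le> w \<bullet> x1"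
      using v(1) unfolding C_def by blast
    obtain u2 s2 x2 where 2: "v2 = (u2, s2)" "0 \<le> x2" "M *v x2 \<le> u2" "s2 \<le> w \<bullet> x2"
      using v(2) unfolding C_def by blast
    have "(k *\<^sub>R u1 + l *\<^sub>R u2, k * s1 + l * s2) \<in> C"
    proof (rule CI)
      show "0 \<le> k *\<^sub>R x1 + l *\<^sub>R x2"
        using 1 2 kl by (simp add: less_eq_vec_def)
      show "M *v (k *\<^sub>R x1 + l *\<^sub>R x2) \<le> k *\<^sub>R u1 + l *\<^sub>R u2"
        using 1 2 kl
        by (simp add: matrix_vector_right_distrib matrix_vector_mult_scaleR less_eq_vec_def
            add_mono mult_left_mono)
      show "k * s1 + l * s2 \<le> w \<bullet> (k *\<^sub>R x1 + l *\<^sub>R x2)"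
        using 1 2 kl by (simp add: inner_add_right add_mono mult_left_mono)
    qed
    then show "k *\<^sub>R v1 + l *\<^sub>R v2 \<in> C"
      using 1 2 by simp
  qed
  moreover have "convex D"
    unfolding D_def by (intro convex_Times) simp_all
  moreover have "(0, 0) \<in> C"
    by (rule CI[of 0]) simp_all
  moreover have "(b, m + 1) \<in> D"
    unfolding D_def by simp
  moreover have "C \<inter> D = {}"
    using bound unfolding C_def D_def by fastforce
  ultimately obtain a \<beta> where a: "a \<noteq> 0" "\<forall>v\<in>C. a \<bullet> v \<le> \<beta>" "\<forall>v\<in>D. \<beta> \<le> a \<bullet> v"
    using separating_hyperplane_sets[of C D] by blast
  obtain a1 \<mu> where a_eq: "a = (a1, \<mu>)"
    by (cases a)
  have C: "a1 \<bullet> u + \<mu> * s \<le> \<beta>" if "(u, s) \<in> C" for u s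
    using a(2) that by (force simp: a_eq)
  have D: "\<beta> \<le> a1 \<bullet> b + \<mu> * s" if "m < s" for s
    using a(3) that by (force simp: a_eq D_def)
  \<comment> \<open>A linear function bounded above along a ray cannot grow on it. This gives both
    sign conditions on the normal and later dual feasibility.\<close>
  have scale: "\<alpha> \<le> 0" if "\<And>k. 0 \<le> k \<Longrightarrow> k * \<alpha> \<le> \<gamma>" for \<alpha> \<gamma> :: real
  proof (rule ccontr)
    assume "\<not> \<alpha> \<le> 0"
    moreover have "0 \<le> \<gamma>"
      using that[of 0] by simp
    ultimately show False
      using that[of "(\<gamma> + 1) / \<alpha>"] by simp
  qed
  have "- \<mu> \<le> 0"
  proof (rule scale)
    show "k * - \<mu> \<le> a1 \<bullet> b + \<mu> * (m + 1) - \<beta>" if "0 \<le> k" for k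
      using D[of "m + 1 + k"] that by (simp add: algebra_simps)
  qed
  have a1: "a1 $ t \<le> 0" for t
  proof (rule scale)
    fix k :: real assume "0 \<le> k"
    then have "(axis t k, 0) \<in> C"
      by (intro CI[of 0]) (simp_all add: less_eq_vec_def axis_def)
    then show "k * a1 $ t \<le> \<beta>"
      using C by (fastforce simp: inner_axis mult.commute)
  qed
  \<comment> \<open>Slater's condition at work: a vertical hyperplane would force 0 \<le>
    \<open>a1 \<bullet> b\<close>, but all summands are nonpositive and \<open>b\<close> is
    positive, so the whole normal would vanish.\<close>
  have "\<mu> \<noteq> 0"
  proof
    assume "\<mu> = 0"
    then have "0 \<le> a1 \<bullet> b"
      using C[OF \<open>(0, 0) \<in> C\<close>] D[of "m + 1"] by simp
    moreover have nonpos: "a1 $ t * b $ t \<le> 0" for t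
      using a1[of t] b[of t] by (simp add: mult_nonpos_nonneg)
    ultimately have "(\<Sum>t\<in>UNIV. - (a1 $ t * b $ t)) = 0"
      by (intro antisym sum_nonneg) (simp_all add: inner_vec_def sum_negf)
    then have "a1 $ t * b $ t = 0" for t
      using nonpos by (subst (asm) sum_nonneg_eq_0_iff) simp_all
    then have "a1 $ t = 0" for t
      using b[of t] by (metis less_irrefl mult_eq_0_iff)
    then have "a1 = 0"
      by (simp add: vec_eq_iff)
    with \<open>\<mu> = 0\<close> a(1) show False
      by (simp add: a_eq zero_prod_def)
  qed
  with \<open>- \<mu> \<le> 0\<close> have \<mu>: "0 < \<mu>"
    by simp
  \<comment> \<open>The normal is rescaled to profit coefficient 1; its negated resource part serves
    as prices.\<close>
  define y where "y = (- 1 / \<mu>) *\<^sub>R a1"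
  have y_inner: "\<mu> * (y \<bullet> u) = - (a1 \<bullet> u)" for u
    using \<mu> by (simp add: y_def)
  show ?thesis
  proof
    show "0 \<le> y"
      using a1 \<mu> by (simp add: less_eq_vec_def y_def divide_nonpos_pos)
    show "w \<bullet> x \<le> y \<bullet> (M *v x)" if "0 \<le> x" for x
    proof -
      \<comment> \<open>\<open>C\<close> contains the whole ray through
        \<open>(M *v x, w \<bullet> x)\<close>, so the constant \<beta> drops out.\<close>
      have "\<mu> * (w \<bullet> x - y \<bullet> (M *v x)) \<le> 0"
      proof (rule scale)
        fix k :: real assume "0 \<le> k"
        then have "(M *v (k *\<^sub>R x), w \<bullet> (k *\<^sub>R x)) \<in> C"
          using that by (intro CI[of "k *\<^sub>R x"]) (simp_all add: less_eq_vec_def)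
        from C[OF this] show "k * (\<mu> * (w \<bullet> x - y \<bullet> (M *v x))) \<le> \<beta>"
          using y_inner[of "M *v x"]
          by (simp add: matrix_vector_mult_scaleR algebra_simps)
      qed
      then show ?thesis
        using \<mu> by (simp add: mult_le_0_iff)
    qed
    show "y \<bullet> b \<le> m"
    \<comment> \<open>The ray \<open>D\<close> excludes its endpoint, so separation is available
      only at profits \<open>m + e\<close>.\<close>
    proof (rule field_le_epsilon)
      fix e :: real assume "0 < e"
      then have "0 \<le> \<mu> * (m + e - y \<bullet> b)"
        using C[OF \<open>(0, 0) \<in> C\<close>] D[of "m + e"] y_inner[of b] by (simp add: algebra_simps)
      then show "y \<bullet> b \<le> m + e"
        using \<mu> by (simp add: zero_le_mult_iff)
    qed
  qed
qed

text \<open>A row with a positive entry in column j bounds variable j, since the other terms of that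
  row are nonnegative. The set is thus a closed subset of a box.\<close>

lemma compact_nonneg_polyhedron:
  fixes M :: "real ^ 'g::finite ^ 'q::finite"
  assumes nonneg: "\<And>t j. 0 \<le> M $ t $ j" and pos: "\<And>j. \<exists>t. 0 < M $ t $ j"
  shows "compact {x. M *v x \<le> b \<and> 0 \<le> x}"
proof -
  obtain \<tau> where \<tau>: "\<And>j. 0 < M $ \<tau> j $ j"
    using pos by metis
  let ?K = "{x. M *v x \<le> b \<and> 0 \<le> x}"
  let ?u = "\<chi> j. b $ \<tau> j / M $ \<tau> j $ j"
  have "x $ j \<le> ?u $ j" if x: "x \<in> ?K" for x j
  proof -
    have "M $ \<tau> j $ j * x $ j \<le> (\<Sum>i\<in>UNIV. M $ \<tau> j $ i * x $ i)"
      using x nonneg by (intro member_le_sum) (auto simp: less_eq_vec_def)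
    also have "\<dots> \<le> b $ \<tau> j"
      using x by (simp add: less_eq_vec_def matrix_vector_mult_def)
    finally show ?thesis
      using \<tau>[of j] by (simp add: field_simps)
  qed
  then have "cbox 0 ?u \<inter> ?K = ?K"
    by (auto simp: mem_box_cart less_eq_vec_def)
  moreover have "closed ?K"
    unfolding less_eq_vec_def matrix_vector_mult_def
    by (intro closed_Collect_conj closed_Collect_all closed_Collect_le continuous_intros)
  ultimately show ?thesis
    using compact_Int_closed[OF compact_cbox[of 0 ?u], of ?K] by simp
qed

lemma compact_inner_attains_sup:
  fixes a :: "'a::real_inner"
  assumes "compact K" "K \<noteq> {}"
  obtains x where "x \<in> K" and "\<And>x'. x' \<in> K \<Longrightarrow> a \<bullet> x' \<le> a \<bullet> x"
  using continuous_attains_sup[OF assms linear_continuous_on[OF bounded_linear_inner_right]] by metis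

section \<open>Values and optimal demands in an LPP situation\<close>

definition owned_technology :: "real ^ 'g ^ ('q option) \<Rightarrow> real ^ 'g ^ 'q" where
  "owned_technology A = (\<chi> t. A $ Some t)"

definition owned_plans :: "real ^ 'g ^ ('q option) \<Rightarrow> real ^ 'n ^ 'q \<Rightarrow> 'n set \<Rightarrow> (real ^ 'g) set" where
  "owned_plans A B S = {x. owned_technology A *v x \<le> coalition_resources B S \<and> 0 \<le> x}"

lemma mem_production_plans_iff:
  fixes A :: "real ^ 'g::finite ^ ('q::finite option)"
  shows "x \<in> production_plans A B S z \<longleftrightarrow> x \<in> owned_plans A B S \<and> A $ None \<bullet> x \<le> z"
proof -
  have "(A *v x) $ None = A $ None \<bullet> x"
    by (simp add: matrix_vector_mult_def inner_vec_def)
  moreover have "(A *v x) $ Some t = (owned_technology A *v x) $ t" for t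
    by (simp add: matrix_vector_mult_def owned_technology_def)
  moreover have "(\<forall>t. f t) \<longleftrightarrow> f None \<and> (\<forall>t. f (Some t))" for f :: "'q option \<Rightarrow> bool"
    by (metis option.exhaust)
  ultimately show ?thesis
    by (auto simp: production_plans_def owned_plans_def available_def less_eq_vec_def)
qed

lemma inner_nonneg_vec:
  fixes a x :: "real ^ 'g::finite"
  assumes "0 \<le> a" "0 \<le> x"
  shows "0 \<le> a \<bullet> x"
  using assms by (simp add: inner_vec_def less_eq_vec_def sum_nonneg)

context
  fixes A :: "real ^ 'g::finite ^ ('q::finite option)"
    and B :: "real ^ 'n::finite ^ 'q"
    and p :: "real ^ 'g"
    and r c :: real
  assumes lpp: "lpp_situation A B p r c"
begin

lemma zero_mem_owned_plans: "0 \<in> owned_plans A B S"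
  using lpp by (auto simp: owned_plans_def coalition_resources_def lpp_situation_def
      less_eq_vec_def column_def intro!: sum_nonneg)

lemma compact_owned_plans: "compact (owned_plans A B S)"
  unfolding owned_plans_def using lpp
  by (intro compact_nonneg_polyhedron) (auto simp: owned_technology_def lpp_situation_def)

lemma compact_production_plans: "compact (production_plans A B S z)"
  unfolding production_plans_def using lpp
  by (intro compact_nonneg_polyhedron) (auto simp: lpp_situation_def)

lemma lp_value_eqI:
  assumes "x \<in> production_plans A B S z"
    and "\<And>x'. x' \<in> production_plans A B S z \<Longrightarrow> p \<bullet> x' \<le> p \<bullet> x"
  shows "lp_value A B p c S z = p \<bullet> x - c * z"
  unfolding lp_value_def using assms by (intro Greatest_equality) auto

text \<open>The zero plan is feasible for nonnegative \<open>z\<close> and the plans form a compact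
  set, so the \<open>GREATEST\<close> in \<open>lp_value\<close> denotes a true maximum.\<close>

lemma lp_value_attained:
  assumes "0 \<le> z"
  obtains x where "x \<in> production_plans A B S z" and "lp_value A B p c S z = p \<bullet> x - c * z"
proof -
  have "0 \<in> production_plans A B S z"
    using assms zero_mem_owned_plans by (simp add: mem_production_plans_iff)
  then obtain x where "x \<in> production_plans A B S z"
    "\<And>x'. x' \<in> production_plans A B S z \<Longrightarrow> p \<bullet> x' \<le> p \<bullet> x"
    using compact_inner_attains_sup[OF compact_production_plans] by blast
  then show thesis
    using that lp_value_eqI by blast
qed

definition unit_profit :: "real ^ 'g" where
  "unit_profit = p - c *\<^sub>R (A $ None)"

text \<open>All of \<open>z\<close> is paid for, but only \<open>A $ None \<bullet> x\<close> of it
  is used; the surplus can only cost money.\<close>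

lemma revenue_minus_cost_le:
  assumes "x \<in> production_plans A B S z"
  shows "p \<bullet> x - c * z \<le> unit_profit \<bullet> x"
  using assms lpp
  by (simp add: unit_profit_def mem_production_plans_iff lpp_situation_def inner_diff_left
      mult_left_mono)

lemma None_inner_nonneg: "x \<in> owned_plans A B S \<Longrightarrow> 0 \<le> A $ None \<bullet> x"
  using lpp by (intro inner_nonneg_vec) (auto simp: owned_plans_def lpp_situation_def less_eq_vec_def)

text \<open>
  The least maximizer of the value is the pool consumption of an optimal plan of the
  unrestricted program that uses as little of the pool as possible.
\<close>

lemma optimal_demand_optimal:
  shows "0 \<le> optimal_demand A B p c S"
    and "x \<in> owned_plans A B S \<Longrightarrow> unit_profit \<bullet> x \<le> lp_value A B p c S (optimal_demand A B p c S)"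
proof -
  let ?K = "owned_plans A B S" and ?f = "lp_value A B p c S"
  obtain x1 where x1: "x1 \<in> ?K" "\<And>x. x \<in> ?K \<Longrightarrow> unit_profit \<bullet> x \<le> unit_profit \<bullet> x1"
    using compact_inner_attains_sup[OF compact_owned_plans] zero_mem_owned_plans by blast
  define m where "m = unit_profit \<bullet> x1"
  define R where "R = {x \<in> ?K. unit_profit \<bullet> x = m}"
  have "R = ?K \<inter> {x. unit_profit \<bullet> x = m}"
    by (auto simp: R_def)
  moreover have "closed {x. unit_profit \<bullet> x = m}"
    by (rule closed_hyperplane)
  ultimately have "compact R"
    by (simp add: compact_Int_closed compact_owned_plans)
  moreover have "x1 \<in> R"
    using x1 by (simp add: R_def m_def)
  ultimately obtain x0 where x0: "x0 \<in> R" "\<And>x. x \<in> R \<Longrightarrow> A $ None \<bullet> x0 \<le> A $ None \<bullet> x"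
    using compact_inner_attains_sup[of R "- (A $ None)"] by (auto simp: inner_minus_left)
  define z0 where "z0 = A $ None \<bullet> x0"
  \<comment> \<open>\<open>x0\<close> consumes exactly \<open>z0\<close>, so no surplus is paid for
    and the bound becomes an equality.\<close>
  have x0_plan: "x0 \<in> production_plans A B S z0" and x0_val: "p \<bullet> x0 - c * z0 = m"
    using x0(1) by (simp_all add: R_def mem_production_plans_iff z0_def unit_profit_def inner_diff_left)
  have z0: "0 \<le> z0"
    unfolding z0_def using x0(1) by (intro None_inner_nonneg[of _ S]) (simp add: R_def)
  have bound: "p \<bullet> x - c * z \<le> unit_profit \<bullet> x" "unit_profit \<bullet> x \<le> m"
    if "x \<in> production_plans A B S z" for x z
    using that x1(2) revenue_minus_cost_le by (auto simp: mem_production_plans_iff m_def)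
  have f_le: "?f z \<le> m" if "0 \<le> z" for z
    using lp_value_attained[OF that, of S] bound by (metis order_trans)
  have f_z0: "?f z0 = m"
    unfolding x0_val[symmetric]
    by (rule lp_value_eqI[OF x0_plan]) (use bound x0_val in fastforce)
  \<comment> \<open>If \<open>z\<close> also yields \<open>m\<close>, its best plan is squeezed
    between the two bounds, hence lies in \<open>R\<close> and uses at least
    \<open>z0\<close>.\<close>
  have least: "z0 \<le> z" if z: "0 \<le> z" "?f z = m" for z
  proof -
    obtain x where x: "x \<in> production_plans A B S z" "p \<bullet> x - c * z = m"
      using lp_value_attained[OF z(1), of S] z(2) by metis
    then have "x \<in> R"
      using bound[of x z] by (auto simp: R_def mem_production_plans_iff)
    then show ?thesis
      using x0(2) x(1) by (fastforce simp: z0_def mem_production_plans_iff)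
  qed
  have "(GREATEST v. \<exists>z'\<ge>0. v = ?f z') = m"
    using z0 f_z0 f_le by (intro Greatest_equality) auto
  then have "optimal_demand A B p c S = z0"
    unfolding optimal_demand_def using z0 f_z0 least by (intro Least_equality) auto
  then show "0 \<le> optimal_demand A B p c S"
    and "x \<in> ?K \<Longrightarrow> unit_profit \<bullet> x \<le> ?f (optimal_demand A B p c S)"
    using z0 f_z0 x1(2) by (simp_all add: m_def)
qed

text \<open>Dual feasibility involves only technology and profits, so the prices found for N bound
  the value of every coalition by weak duality. As \<open>z\<close> is arbitrary, the bound survives
  any allocation procedure.\<close>

lemma owen_vector:
  obtains x where "(\<Sum>i\<in>UNIV. x $ i) \<le> lp_value A B p c UNIV (optimal_demand A B p c UNIV)"
    and "\<And>S z. 0 \<le> z \<Longrightarrow> lp_value A B p c S z \<le> (\<Sum>i\<in>S. x $ i)"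
proof -
  let ?m = "lp_value A B p c UNIV (optimal_demand A B p c UNIV)"
  \<comment> \<open>Slater's condition is secured for N, as every resource has an owner; a smaller
    coalition may lack some resource.\<close>
  have "0 < coalition_resources B UNIV $ t" for t
  proof -
    obtain i where "0 < B $ t $ i"
      using lpp unfolding lpp_situation_def by meson
    then show ?thesis
      using lpp by (auto simp: coalition_resources_def column_def lpp_situation_def intro!: sum_pos2)
  qed
  then obtain y where y: "0 \<le> y"
    "\<And>x. 0 \<le> x \<Longrightarrow> unit_profit \<bullet> x \<le> y \<bullet> (owned_technology A *v x)"
    "y \<bullet> coalition_resources B UNIV \<le> ?m"
    using strong_duality_slater[of "coalition_resources B UNIV" "owned_technology A" unit_profit ?m]
      optimal_demand_optimal(2)[of _ UNIV]
    by (auto simp: owned_plans_def)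
  define x where "x = (\<chi> i. y \<bullet> column i B)"
  have sum_x: "(\<Sum>i\<in>S. x $ i) = y \<bullet> coalition_resources B S" for S
    by (simp add: x_def coalition_resources_def inner_sum_right)
  show thesis
  proof
    show "(\<Sum>i\<in>UNIV. x $ i) \<le> ?m"
      using y(3) by (simp add: sum_x)
    show "lp_value A B p c S z \<le> (\<Sum>i\<in>S. x $ i)" if z: "0 \<le> z" for S z
    proof -
      obtain u where u: "u \<in> production_plans A B S z" "lp_value A B p c S z = p \<bullet> u - c * z"
        using lp_value_attained[OF z] .
      then have owned: "owned_technology A *v u \<le> coalition_resources B S" "0 \<le> u"
        by (simp_all add: mem_production_plans_iff owned_plans_def)
      have "lp_value A B p c S z \<le> unit_profit \<bullet> u"
        using u revenue_minus_cost_le by simp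
      also have "\<dots> \<le> y \<bullet> (owned_technology A *v u)"
        using y(2) owned(2) .
      also have "\<dots> \<le> y \<bullet> coalition_resources B S"
        using inner_nonneg_vec[OF y(1), of "coalition_resources B S - owned_technology A *v u"] owned(1)
        by (simp add: inner_diff_right)
      finally show ?thesis
        by (simp add: sum_x)
    qed
  qed
qed

end

section \<open>Cores of partition function form games\<close>

text \<open>This makes \<open>v_plus\<close> and \<open>v_minus\<close> agree at N, so both cores
  share the same efficiency condition.\<close>

lemma partition_on_UNIV_containing_UNIV:
  "partition_on UNIV P \<and> UNIV \<in> P \<longleftrightarrow> P = {UNIV}"
proof
  assume P: "partition_on UNIV P \<and> UNIV \<in> P"
  have "S = UNIV" if "S \<in> P" for S
    using P that partition_onD2[of UNIV P] partition_onD3[of UNIV P]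
    by (metis Int_UNIV_right disjointD)
  then show "P = {UNIV}"
    using P by blast
qed (simp add: partition_on_space)

text \<open>Ensures that \<open>Min\<close> and \<open>Max\<close> range over nonempty sets and that
  \<open>dom_all\<close> is never vacuous. S = N is separate because its complement is no
  block.\<close>

lemma exists_partition_containing:
  assumes "S \<noteq> {}"
  shows "\<exists>P. partition_on UNIV P \<and> S \<in> P"
proof (cases "S = UNIV")
  case True
  then show ?thesis
    by (metis partition_on_UNIV_containing_UNIV)
next
  case False
  then have "partition_on UNIV {S, - S}"
    using assms by (auto simp: partition_on_def disjoint_def)
  then show ?thesis
    by blast
qed

lemma v_plus_UNIV: "v_plus V UNIV = V UNIV {UNIV}"
  by (simp add: v_plus_def partition_on_UNIV_containing_UNIV)

lemma v_minus_UNIV: "v_minus V UNIV = V UNIV {UNIV}"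
  by (simp add: v_minus_def partition_on_UNIV_containing_UNIV)

lemma v_plus_le_iff:
  fixes V :: "'n::finite set \<Rightarrow> 'n set set \<Rightarrow> real"
  assumes "S \<noteq> {}"
  shows "v_plus V S \<le> a \<longleftrightarrow> (\<forall>P. partition_on UNIV P \<and> S \<in> P \<longrightarrow> V S P \<le> a)"
proof -
  have "finite {V S P |P. partition_on UNIV P \<and> S \<in> P}"
    by simp
  then show ?thesis
    using exists_partition_containing[OF assms] assms by (auto simp: v_plus_def)
qed

lemma v_minus_le_v_plus: "v_minus V S \<le> v_plus V S"
proof (cases "S = {}")
  case False
  then obtain P where P: "partition_on UNIV P" "S \<in> P"
    using exists_partition_containing[OF False] by blast
  have "v_minus V S \<le> V S P"
    using P False by (auto simp: v_minus_def intro!: Min_le)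
  also have "V S P \<le> v_plus V S"
    using v_plus_le_iff[OF False, of V "v_plus V S"] P by simp
  finally show ?thesis .
qed (simp add: v_minus_def v_plus_def)

lemma core_v_plus_subset_core_v_minus: "core (v_plus V) \<subseteq> core (v_minus V)"
  unfolding core_def v_plus_UNIV v_minus_UNIV using order_trans[OF v_minus_le_v_plus] by blast

text \<open>A blocking coalition would need more than its \<open>v_plus\<close>, the most that any
  partition grants it.\<close>

lemma core_v_plus_subset_pff_core_bar: "core (v_plus V) \<subseteq> pff_core_bar V"
proof
  fix x assume x: "x \<in> core (v_plus V)"
  have "feasible_under V {UNIV} x"
    using x by (simp add: core_def feasible_under_def v_plus_UNIV)
  then have "x \<in> feasible_set V"
    unfolding feasible_set_def by (blast intro: partition_on_space[OF UNIV_not_empty])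
  moreover have "\<not> dom_some V x' x" for x'
  proof
    assume "dom_some V x' x"
    then obtain S P where S: "S \<noteq> {}" "\<forall>i\<in>S. x $ i < x' $ i"
      and P: "partition_on UNIV P" "S \<in> P" "(\<Sum>i\<in>S. x' $ i) \<le> V S P"
      by (auto simp: dom_some_def)
    have "(\<Sum>i\<in>S. x $ i) < (\<Sum>i\<in>S. x' $ i)"
      using S by (intro sum_strict_mono) auto
    moreover have "v_plus V S \<le> (\<Sum>i\<in>S. x $ i)"
      using x by (simp add: core_def)
    then have "V S P \<le> (\<Sum>i\<in>S. x $ i)"
      using v_plus_le_iff[OF S(1), of V] P(1,2) by blast
    ultimately show False
      using P(3) by simp
  qed
  ultimately show "x \<in> pff_core_bar V"
    by (simp add: pff_core_bar_def)
qed

lemma pff_core_bar_subset_pff_core: "pff_core_bar V \<subseteq> pff_core V"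
proof -
  have "dom_some V x' x" if "dom_all V x' x" for x' x
    using that exists_partition_containing unfolding dom_all_def dom_some_def by metis
  then show ?thesis
    by (auto simp: pff_core_bar_def pff_core_def)
qed

theorem corollary19:
  fixes A :: "real ^ 'g::finite ^ ('q::finite option)"
    and B :: "real ^ 'n::finite ^ 'q"
    and p :: "real ^ 'g"
    and r c :: real
    and z :: "'n set \<Rightarrow> 'n set set \<Rightarrow> real"
    and V :: "'n set \<Rightarrow> 'n set set \<Rightarrow> real"
  assumes "lpp_situation A B p r c"
    and "manager_allocation A B p r c z"
    and "V = lpp_game A B p c z"
    and "optimal_demand A B p c UNIV \<le> r"
  shows "(core (v_plus V) \<noteq> {} \<and> pff_core_bar V \<noteq> {}) \<and>
         (core (v_minus V) \<noteq> {} \<and> pff_core V \<noteq> {})"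
proof -
  let ?d = "optimal_demand A B p c UNIV"
  \<comment> \<open>Here d_N \<le> r enters: the manager gives N its full optimal demand.\<close>
  have V_N: "V UNIV {UNIV} = lp_value A B p c UNIV ?d"
    using assms by (simp add: lpp_game_def manager_allocation_def)
  obtain x where x: "(\<Sum>i\<in>UNIV. x $ i) \<le> lp_value A B p c UNIV ?d"
    "\<And>S z. 0 \<le> z \<Longrightarrow> lp_value A B p c S z \<le> (\<Sum>i\<in>S. x $ i)"
    using owen_vector[OF assms(1)] by metis
  have "v_plus V S \<le> (\<Sum>i\<in>S. x $ i)" for S
  proof (cases "S = {}")
    case False
    then show ?thesis
      using assms(2) x(2) by (auto simp: v_plus_le_iff assms(3) lpp_game_def manager_allocation_def)
  qed (simp add: v_plus_def)
  \<comment> \<open>The reverse inequality is the coalition bound for N itself at its optimal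
    demand.\<close>
  moreover have "(\<Sum>i\<in>UNIV. x $ i) = v_plus V UNIV"
    using x optimal_demand_optimal(1)[OF assms(1)] by (simp add: v_plus_UNIV V_N antisym)
  ultimately have "x \<in> core (v_plus V)"
    by (simp add: core_def)
  then show ?thesis
    using core_v_plus_subset_core_v_minus core_v_plus_subset_pff_core_bar
      pff_core_bar_subset_pff_core by blast
qed

end
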